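(* Let $\psi(p)=(\phi_1(a,b),\phi_2(a,b))$, $p=(a,b)$, be a bicomplex function that is continuous in a domain $G\subseteq\mathrm{B}$. Then the integral $\int_\Gamma\psi(p)\odot dp$ over an arbitrary curve $\Gamma$ in $G$ depends only on the end points of $\Gamma$ if and only if $\psi$ is the derivative of a holomorphic bicomplex function $\Psi$ in $G$ (i.e. there is $\Psi$ holomorphic in $G$ with $\Psi'=\psi$ in $G$).
   Context: $\mathrm{B}=\mathbb{C}^2$ is the space of bicomplex numbers $p=(a,b)$, $a,b\in\mathbb{C}$, with componentwise addition and the commutative multiplication $(a,b)\odot(c,d)=(ac-bd,\ bc+ad)$. The norm is $\|(a,b)\|=\sqrt{|a|^2+|b|^2}$. A bicomplex number $(a,b)$ is singular if $a^2+b^2=0$, and nonsingular otherwise; a nonsingular $(a,b)$ has the inverse $\left(\frac{a}{a^2+b^2},\frac{-b}{a^2+b^2}\right)$, and $r/q=r\odot q^{-1}$ for nonsingular $q$. A domain is a connected open set. A bicomplex function $\Psi$ is holomorphic in $G$ if at every $p\in G$ the derivative $$\Psi'(p)=\lim_{\Delta p\to 0,\ \Delta p\ \text{nonsingular}}\frac{\Psi(p+\Delta p)-\Psi(p)}{\Delta p}$$ exists (the limit being taken over nonsingular $\Delta p$ only). A curve $\Gamma$ in $\mathrm{B}$ is a piecewise continuously differentiable path $p(t)=(a(t),b(t))$, $r\le t\le s$, and the line integral is $\int_\Gamma\psi(p)\odot dp=\int_r^s\psi(p(t))\odot p'(t)\,dt$ (computed over subintervals where $p'$ is continuous). *)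

theory Defs
  imports "HOL-Analysis.Analysis"
begin

text \<open>The product type already carries the componentwise addition and the norm
  \<open>norm (a, b) = sqrt ((norm a)\<^sup>2 + (norm b)\<^sup>2)\<close>.\<close>

type_synonym bicomplex = "complex \<times> complex"

definition bc_mult :: "bicomplex \<Rightarrow> bicomplex \<Rightarrow> bicomplex" (infixl "\<odot>" 70) where
  "p \<odot> q = (case p of (a, b) \<Rightarrow> case q of (c, d) \<Rightarrow> (a * c - b * d, b * c + a * d))"

definition bc_nonsingular :: "bicomplex \<Rightarrow> bool" where
  "bc_nonsingular p \<longleftrightarrow> (case p of (a, b) \<Rightarrow> a\<^sup>2 + b\<^sup>2 \<noteq> 0)"

text \<open>Meaningful for nonsingular arguments only.\<close>

definition bc_inverse :: "bicomplex \<Rightarrow> bicomplex" where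
  "bc_inverse p = (case p of (a, b) \<Rightarrow> (a / (a\<^sup>2 + b\<^sup>2), - b / (a\<^sup>2 + b\<^sup>2)))"

definition bc_divide :: "bicomplex \<Rightarrow> bicomplex \<Rightarrow> bicomplex" (infixl "\<oslash>" 70) where
  "r \<oslash> q = r \<odot> bc_inverse q"

definition bc_has_derivative :: "(bicomplex \<Rightarrow> bicomplex) \<Rightarrow> bicomplex \<Rightarrow> bicomplex \<Rightarrow> bool" where
  "bc_has_derivative \<Psi> D p \<longleftrightarrow>
     ((\<lambda>h. (\<Psi> (p + h) - \<Psi> p) \<oslash> h) \<longlongrightarrow> D) (at 0 within {h. bc_nonsingular h})"

definition bc_holomorphic_on :: "(bicomplex \<Rightarrow> bicomplex) \<Rightarrow> bicomplex set \<Rightarrow> bool" where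
  "bc_holomorphic_on \<Psi> G \<longleftrightarrow> (\<forall>p\<in>G. \<exists>D. bc_has_derivative \<Psi> D p)"

text \<open>A curve is given by a function \<open>\<gamma>\<close> and its parameter interval \<open>[r, s]\<close>; values of \<open>\<gamma>\<close>
  outside that interval are irrelevant. The interval splits into finitely many closed
  pieces, and on each of them \<open>\<gamma>\<close> is continuously differentiable up to the end points
  (one-sided derivatives there). In contrast, \<open>piecewise_C1_differentiable_on\<close>
  allows a derivative that is unbounded near an exceptional point, in which case the line integral
  of a continuous function need not exist. The case \<open>n = 0\<close> is the degenerate interval
  \<open>r = s\<close>.\<close>

definition bc_curve :: "(real \<Rightarrow> bicomplex) \<Rightarrow> real \<Rightarrow> real \<Rightarrow> bool" where
  "bc_curve \<gamma> r s \<longleftrightarrow>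
     continuous_on {r..s} \<gamma> \<and>
     (\<exists>(n::nat) (t::nat \<Rightarrow> real). t 0 = r \<and> t n = s \<and>
        (\<forall>i<n. t i < t (Suc i) \<and>
           (\<exists>\<gamma>'. continuous_on {t i..t (Suc i)} \<gamma>' \<and>
              (\<forall>x\<in>{t i..t (Suc i)}.
                 (\<gamma> has_vector_derivative \<gamma>' x) (at x within {t i..t (Suc i)})))))"

text \<open>At the finitely many points where the pieces meet, \<open>vector_derivative\<close> may be
  arbitrary; this does not affect the integral, which is therefore the sum of the integrals over
  the pieces.\<close>

definition bc_line_integral ::
  "(bicomplex \<Rightarrow> bicomplex) \<Rightarrow> (real \<Rightarrow> bicomplex) \<Rightarrow> real \<Rightarrow> real \<Rightarrow> bicomplex" where
  "bc_line_integral \<psi> \<gamma> r s =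
     integral {r..s} (\<lambda>t. \<psi> (\<gamma> t) \<odot> vector_derivative \<gamma> (at t within {r..s}))"

definition bc_path_independent :: "(bicomplex \<Rightarrow> bicomplex) \<Rightarrow> bicomplex set \<Rightarrow> bool" where
  "bc_path_independent \<psi> G \<longleftrightarrow>
     (\<forall>\<gamma>\<^sub>1 r\<^sub>1 s\<^sub>1 \<gamma>\<^sub>2 r\<^sub>2 s\<^sub>2.
        bc_curve \<gamma>\<^sub>1 r\<^sub>1 s\<^sub>1 \<and> \<gamma>\<^sub>1 ` {r\<^sub>1..s\<^sub>1} \<subseteq> G \<and>
        bc_curve \<gamma>\<^sub>2 r\<^sub>2 s\<^sub>2 \<and> \<gamma>\<^sub>2 ` {r\<^sub>2..s\<^sub>2} \<subseteq> G \<and>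
        \<gamma>\<^sub>1 r\<^sub>1 = \<gamma>\<^sub>2 r\<^sub>2 \<and> \<gamma>\<^sub>1 s\<^sub>1 = \<gamma>\<^sub>2 s\<^sub>2 \<longrightarrow>
        bc_line_integral \<psi> \<gamma>\<^sub>1 r\<^sub>1 s\<^sub>1 = bc_line_integral \<psi> \<gamma>\<^sub>2 r\<^sub>2 s\<^sub>2)"

end

(* A bicomplex derivative controls difference quotients along nonsingular increments only. Since
   nonsingular increments are dense and a function that is differentiable near p is continuous
   along them, the estimate extends to all increments: a holomorphic \<Psi> is
   Frechet differentiable with derivative h \<mapsto> \<Psi>'(p) \<odot> h, so the fundamental theorem of calculus
   evaluates the line integral along any curve. Conversely, path independence yields a primitive
   with \<Psi>(p + h) - \<Psi>(p) = (integral of \<psi>(p + t h) over [0, 1]) \<odot> h; for nonsingular h the factor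
   h cancels exactly, so near-singular increments cause no blow-up. *)
theory Submission
  imports Defs
begin

section \<open>Bicomplex algebra\<close>

text \<open>Each of the four complex products in the two components is at most
  \<open>norm p * norm q\<close>. The constant 4 is crude; boundedness of the product is all it has
  to provide.\<close>

lemma norm_bc_mult_le: "norm (p \<odot> q) \<le> norm p * norm q * 4"
proof -
  obtain a b c d where pq: "p = (a, b)" "q = (c, d)"
    by (metis surj_pair)
  have le: "norm a \<le> norm p" "norm b \<le> norm p" "norm c \<le> norm q" "norm d \<le> norm q"
    unfolding pq by (rule norm_fst_le norm_snd_le)+
  have prods: "norm (x * y) \<le> norm p * norm q"
    if "norm x \<le> norm p" "norm y \<le> norm q" for x y :: complex
    using that by (simp add: norm_mult mult_mono)
  have "norm (p \<odot> q) \<le> norm (a * c - b * d) + norm (b * c + a * d)"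
    unfolding pq bc_mult_def using norm_Pair_le by simp
  also have "\<dots> \<le> norm (a * c) + norm (b * d) + (norm (b * c) + norm (a * d))"
    by (intro add_mono norm_triangle_ineq4 norm_triangle_ineq)
  also have "\<dots> \<le> norm p * norm q * 4"
    using prods[of a c] prods[of b d] prods[of b c] prods[of a d] le by simp
  finally show ?thesis .
qed

lemma bounded_bilinear_bc_mult: "bounded_bilinear (\<odot>)"
proof
  show "\<exists>K. \<forall>a b. norm (a \<odot> b) \<le> norm a * norm b * K"
    using norm_bc_mult_le by blast
qed (auto simp: bc_mult_def algebra_simps)

interpretation bc_mult: bounded_bilinear "(\<odot>)"
  by (rule bounded_bilinear_bc_mult)

lemma not_bc_nonsingular_0: "\<not> bc_nonsingular 0"
  by (simp add: bc_nonsingular_def zero_prod_def)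

text \<open>For \<open>h = (c, d)\<close>, multiplying by the conjugate \<open>(c, - d)\<close>
  gives \<open>(c\<^sup>2 + d\<^sup>2, 0)\<close>. The identities \<open>eqs\<close> are this
  computation with the factor \<open>p\<close> in front.\<close>

lemma bc_mult_divide_cancel:
  assumes "bc_nonsingular h"
  shows "(p \<odot> h) \<oslash> h = p"
proof -
  obtain a b c d where ph: "p = (a, b)" "h = (c, d)"
    by (metis surj_pair)
  define n where "n = c\<^sup>2 + d\<^sup>2"
  have "n \<noteq> 0"
    using assms by (simp add: ph bc_nonsingular_def n_def)
  have eqs: "(a * c - b * d) * c + (b * c + a * d) * d = a * n"
      "(b * c + a * d) * c - (a * c - b * d) * d = b * n"
    by (simp_all add: n_def algebra_simps power2_eq_square)
  have "(p \<odot> h) \<oslash> h = (((a * c - b * d) * c + (b * c + a * d) * d) / n,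
      ((b * c + a * d) * c - (a * c - b * d) * d) / n)"
    unfolding ph bc_divide_def bc_inverse_def bc_mult_def prod.case n_def[symmetric]
    by (simp only: add_divide_distrib diff_divide_distrib times_divide_eq_right
          minus_divide_left mult_minus_right prod.inject) simp
  with \<open>n \<noteq> 0\<close> show ?thesis
    by (simp add: ph eqs)
qed

text \<open>Commutativity and associativity swap the factor \<open>h\<close> with its inverse, which
  reduces the claim to the previous cancellation.\<close>

lemma bc_divide_mult_cancel:
  assumes "bc_nonsingular h"
  shows "(p \<oslash> h) \<odot> h = p"
proof -
  have "(p \<oslash> h) \<odot> h = (p \<odot> h) \<oslash> h"
    by (simp add: bc_divide_def bc_mult_def split: prod.splits) (auto simp: algebra_simps)
  then show ?thesis
    using bc_mult_divide_cancel[OF assms] by simp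
qed

text \<open>Density of nonsingular increments: \<open>a\<^sup>2 + b\<^sup>2\<close> factors as
  \<open>(a - \<i> * b) * (a + \<i> * b)\<close>, and after the shift of \<open>a\<close> by a real
  \<open>t\<close> each factor vanishes for at most one \<open>t\<close>. Comparing real parts names
  the two candidates; a punctured neighbourhood of 0 avoids both, even if \<open>h\<close> itself is
  singular.\<close>

lemma eventually_bc_nonsingular_shift:
  "eventually (\<lambda>t::real. bc_nonsingular (h + (of_real t, 0))) (at 0)"
proof -
  obtain a b where h: "h = (a, b)"
    by (metis surj_pair)
  have "eventually (\<lambda>t::real. t \<noteq> Re (\<i> * b - a) \<and> t \<noteq> Re (- \<i> * b - a)) (at 0)"
    by (intro eventually_conj eventually_neq_at_within)
  then show ?thesis
  proof (rule eventually_mono)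
    fix t :: real
    assume t: "t \<noteq> Re (\<i> * b - a) \<and> t \<noteq> Re (- \<i> * b - a)"
    have "(a + of_real t)\<^sup>2 + b\<^sup>2 = (a + of_real t - \<i> * b) * (a + of_real t + \<i> * b)"
      by (simp add: algebra_simps power2_eq_square)
    moreover have "a + of_real t - \<i> * b \<noteq> 0"
      using t by (auto simp: complex_eq_iff)
    moreover have "a + of_real t + \<i> * b \<noteq> 0"
      using t by (auto simp: complex_eq_iff)
    ultimately show "bc_nonsingular (h + (of_real t, 0))"
      by (simp add: h bc_nonsingular_def)
  qed
qed

section \<open>Derivatives and line integrals\<close>

lemma real_increment_tendsto_0: "((\<lambda>t. (of_real t, 0)) \<longlongrightarrow> (0 :: bicomplex)) (at 0)"
  unfolding zero_prod_def by (intro tendsto_Pair tendsto_const) (auto intro!: tendsto_eq_intros)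

text \<open>A weak form of continuity, along real increments only. These are nonsingular for
  \<open>t \<noteq> 0\<close>, so the difference quotient converges along them; multiplying it by
  the increment, which tends to 0, recovers the difference.\<close>

lemma bc_has_derivative_shift_tendsto:
  assumes "bc_has_derivative \<Psi> D q"
  shows "((\<lambda>t::real. \<Psi> (q + (of_real t, 0))) \<longlongrightarrow> \<Psi> q) (at 0)"
proof -
  let ?k = "\<lambda>t::real. (of_real t, 0) :: bicomplex"
  note k0 = real_increment_tendsto_0
  have ns: "eventually (\<lambda>t. bc_nonsingular (?k t) \<and> ?k t \<noteq> 0) (at 0)"
    unfolding eventually_at by (auto intro!: exI[of _ 1] simp: bc_nonsingular_def zero_prod_def)
  have "filterlim ?k (at 0 within {h. bc_nonsingular h}) (at 0)"
    unfolding filterlim_at using k0 ns by auto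
  with assms have "((\<lambda>t. (\<Psi> (q + ?k t) - \<Psi> q) \<oslash> ?k t) \<longlongrightarrow> D) (at 0)"
    unfolding bc_has_derivative_def by (rule filterlim_compose)
  then have "((\<lambda>t. ((\<Psi> (q + ?k t) - \<Psi> q) \<oslash> ?k t) \<odot> ?k t) \<longlongrightarrow> D \<odot> 0) (at 0)"
    using k0 by (rule bc_mult.tendsto)
  moreover have "eventually (\<lambda>t. ((\<Psi> (q + ?k t) - \<Psi> q) \<oslash> ?k t) \<odot> ?k t = \<Psi> (q + ?k t) - \<Psi> q) (at 0)"
    using ns by (rule eventually_mono) (simp add: bc_divide_mult_cancel)
  ultimately have "((\<lambda>t. \<Psi> (q + ?k t) - \<Psi> q) \<longlongrightarrow> 0) (at 0)"
    unfolding bc_mult.zero_right by (rule Lim_transform_eventually)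
  then show ?thesis
    by (rule LIM_zero_cancel)
qed

text \<open>The error estimate is immediate for nonsingular increments. An arbitrary increment is
  the limit of nonsingular ones obtained by real shifts, and both sides of the estimate converge
  along them.\<close>

lemma bc_holomorphic_imp_has_derivative:
  assumes "open G" "bc_holomorphic_on \<Psi> G" "p \<in> G" and D: "bc_has_derivative \<Psi> D p"
  shows "(\<Psi> has_derivative (\<lambda>h. D \<odot> h)) (at p)"
  unfolding has_derivative_at_alt
proof (intro conjI allI impI)
  show "bounded_linear (\<lambda>h. D \<odot> h)"
    by (rule bc_mult.bounded_linear_right)
  fix e :: real
  assume "e > 0"
  \<comment> \<open>The choice \<open>e / 4\<close> absorbs the factor 4 of
    \<open>norm_bc_mult_le\<close>.\<close>
  then have "eventually (\<lambda>h. dist ((\<Psi> (p + h) - \<Psi> p) \<oslash> h) D < e / 4)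
      (at 0 within {h. bc_nonsingular h})"
    using D unfolding bc_has_derivative_def by (intro tendstoD) auto
  then obtain d1 where d1: "d1 > 0"
    and close: "\<And>h. \<lbrakk>bc_nonsingular h; norm h < d1\<rbrakk> \<Longrightarrow>
        norm ((\<Psi> (p + h) - \<Psi> p) \<oslash> h - D) < e / 4"
    unfolding eventually_at dist_norm diff_0_right using not_bc_nonsingular_0
    by (metis mem_Collect_eq)
  obtain d2 where d2: "d2 > 0" "ball p d2 \<subseteq> G"
    using assms by (meson open_contains_ball)
  have est: "norm (\<Psi> (p + h) - \<Psi> p - D \<odot> h) \<le> e * norm h"
    if h: "bc_nonsingular h" "norm h < d1" for h
  proof -
    have "\<Psi> (p + h) - \<Psi> p - D \<odot> h = ((\<Psi> (p + h) - \<Psi> p) \<oslash> h - D) \<odot> h"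
      using h by (simp add: bc_mult.diff_left bc_divide_mult_cancel)
    also have "norm \<dots> \<le> norm ((\<Psi> (p + h) - \<Psi> p) \<oslash> h - D) * norm h * 4"
      by (rule norm_bc_mult_le)
    also have "\<dots> \<le> e / 4 * norm h * 4"
      using close[OF h] by (intro mult_right_mono) auto
    finally show ?thesis
      by simp
  qed
  show "\<exists>d>0. \<forall>y. norm (y - p) < d \<longrightarrow> norm (\<Psi> y - \<Psi> p - D \<odot> (y - p)) \<le> e * norm (y - p)"
  proof (intro exI[of _ "min d1 d2"] conjI allI impI)
    fix y
    assume y: "norm (y - p) < min d1 d2"
    define h where "h = y - p"
    let ?h = "\<lambda>t::real. h + (of_real t, 0)"
    have "y \<in> G"
      using y d2 by (auto simp: dist_norm norm_minus_commute)
    \<comment> \<open>Differentiability at \<open>y\<close>, and not just at \<open>p\<close>, ties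
      \<open>\<Psi> y\<close> to the values at the shifted points.\<close>
    then obtain D' where "bc_has_derivative \<Psi> D' y"
      using assms(2) unfolding bc_holomorphic_on_def by blast
    then have "((\<lambda>t. \<Psi> (y + (of_real t, 0))) \<longlongrightarrow> \<Psi> y) (at (0::real))"
      by (rule bc_has_derivative_shift_tendsto)
    moreover have "y + (of_real t, 0) = p + ?h t" for t
      by (simp add: h_def algebra_simps)
    ultimately have \<Psi>_lim: "((\<lambda>t. \<Psi> (p + ?h t)) \<longlongrightarrow> \<Psi> y) (at 0)"
      by simp
    have h_lim: "(?h \<longlongrightarrow> h) (at 0)"
      using tendsto_add[OF tendsto_const real_increment_tendsto_0, of h] by simp
    have "eventually (\<lambda>t. norm (?h t) < d1) (at 0)"
      using order_tendstoD(2)[OF tendsto_norm[OF h_lim]] y by (simp add: h_def)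
    \<comment> \<open>For small \<open>t \<noteq> 0\<close> the shifted increment is nonsingular and
      still shorter than \<open>d1\<close>, so \<open>est\<close> applies. The non-strict inequality
      then survives the limit \<open>t \<rightarrow> 0\<close>.\<close>
    with eventually_bc_nonsingular_shift[of h]
    have "eventually (\<lambda>t. norm (\<Psi> (p + ?h t) - \<Psi> p - D \<odot> ?h t) \<le> e * norm (?h t)) (at 0)"
      by eventually_elim (rule est)
    moreover have "((\<lambda>t. norm (\<Psi> (p + ?h t) - \<Psi> p - D \<odot> ?h t)) \<longlongrightarrow>
        norm (\<Psi> y - \<Psi> p - D \<odot> h)) (at 0)"
      by (intro tendsto_intros bc_mult.tendsto \<Psi>_lim h_lim)
    moreover have "((\<lambda>t. e * norm (?h t)) \<longlongrightarrow> e * norm h) (at 0)"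
      by (intro tendsto_intros h_lim)
    ultimately show "norm (\<Psi> y - \<Psi> p - D \<odot> (y - p)) \<le> e * norm (y - p)"
      unfolding h_def[symmetric] by (intro tendsto_le[OF trivial_limit_at])
  qed (use d1 d2 in auto)
qed

section \<open>Evaluating line integrals by a primitive\<close>

lemma bc_curve_le:
  assumes "bc_curve \<gamma> r s"
  shows "r \<le> s"
proof -
  obtain n t where t: "t 0 = r" "t n = s" "\<forall>i<n. t i < t (Suc i)"
    using assms unfolding bc_curve_def by blast
  have "k \<le> n \<Longrightarrow> t 0 \<le> t k" for k
    using t(3) by (induction k) (auto, meson Suc_le_lessD less_imp_le order_trans)
  then show ?thesis
    using t by blast
qed

text \<open>The right end of the piece is the first grid point exceeding \<open>x\<close>; its
  predecessor does not exceed \<open>x\<close> and differs from it.\<close>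

lemma grid_piece_exists:
  fixes t :: "nat \<Rightarrow> 'a::linorder"
  assumes "t 0 < x" "x < t n" "x \<notin> t ` {..n}"
  obtains i where "i < n" "t i < x" "x < t (Suc i)"
proof -
  define k where "k = (LEAST k. x < t k)"
  have "x < t k"
    unfolding k_def by (rule LeastI) (fact assms(2))
  have "k \<le> n"
    unfolding k_def by (rule Least_le) (fact assms(2))
  have "k \<noteq> 0"
    using \<open>x < t k\<close> assms(1) by (metis less_asym)
  then obtain i where i: "k = Suc i"
    by (metis not0_implies_Suc)
  then have "\<not> x < t i"
    using not_less_Least[of i "\<lambda>k. x < t k"] unfolding k_def by simp
  moreover have "x \<noteq> t i"
    using assms(3) i \<open>k \<le> n\<close> by auto
  ultimately show thesis
    using that[of i] i \<open>k \<le> n\<close> \<open>x < t k\<close> by auto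
qed

text \<open>The exceptional set consists of the grid points. Any other point is interior to a piece,
  where the derivative within the piece is a full derivative and hence the one that
  \<open>vector_derivative\<close> selects.\<close>

lemma bc_curve_differentiable:
  assumes "bc_curve \<gamma> r s"
  obtains S where "finite S"
    and "\<And>x. x \<in> {r<..<s} - S \<Longrightarrow>
      (\<gamma> has_vector_derivative vector_derivative \<gamma> (at x within {r..s})) (at x)"
proof -
  obtain n t where t: "t 0 = r" "t n = s"
    and C1: "\<forall>i<n. t i < t (Suc i) \<and> (\<exists>\<gamma>'. continuous_on {t i..t (Suc i)} \<gamma>' \<and>
        (\<forall>x\<in>{t i..t (Suc i)}. (\<gamma> has_vector_derivative \<gamma>' x) (at x within {t i..t (Suc i)})))"
    using assms unfolding bc_curve_def by blast
  show thesis
  proof (rule that)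
    show "finite (t ` {..n})"
      by simp
    fix x
    assume x: "x \<in> {r<..<s} - t ` {..n}"
    then obtain i where i: "i < n" "t i < x" "x < t (Suc i)"
      using grid_piece_exists[of t x n] t by auto
    then obtain v where "(\<gamma> has_vector_derivative v) (at x within {t i..t (Suc i)})"
      using C1 by (metis atLeastAtMost_iff less_imp_le)
    then have "(\<gamma> has_vector_derivative v) (at x)"
      using i by (simp add: at_within_Icc_at)
    moreover have "at x within {r..s} = at x"
      using x by (auto intro: at_within_Icc_at)
    ultimately show "(\<gamma> has_vector_derivative vector_derivative \<gamma> (at x within {r..s})) (at x)"
      by (simp add: vector_derivative_at)
  qed
qed

text \<open>The chain rule makes the integrand the derivative of
  \<open>\<Psi> \<circ> \<gamma>\<close> off a finite set. As this composition is continuous, the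
  fundamental theorem with finitely many exceptions yields both integrability and the value.\<close>

lemma bc_line_integral_primitive:
  assumes curve: "bc_curve \<gamma> r s" and G: "\<gamma> ` {r..s} \<subseteq> G"
    and \<Psi>: "\<And>p. p \<in> G \<Longrightarrow> (\<Psi> has_derivative (\<lambda>h. \<psi> p \<odot> h)) (at p)"
  shows "bc_line_integral \<psi> \<gamma> r s = \<Psi> (\<gamma> s) - \<Psi> (\<gamma> r)"
proof -
  obtain S where S: "finite S" "\<And>x. x \<in> {r<..<s} - S \<Longrightarrow>
      (\<gamma> has_vector_derivative vector_derivative \<gamma> (at x within {r..s})) (at x)"
    using bc_curve_differentiable[OF curve] by blast
  have "((\<lambda>t. \<psi> (\<gamma> t) \<odot> vector_derivative \<gamma> (at t within {r..s})) has_integral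
      (\<Psi> \<circ> \<gamma>) s - (\<Psi> \<circ> \<gamma>) r) {r..s}"
  proof (rule fundamental_theorem_of_calculus_interior_strong[OF S(1) bc_curve_le[OF curve]])
    fix x
    assume x: "x \<in> {r<..<s} - S"
    let ?v = "vector_derivative \<gamma> (at x within {r..s})"
    have "(\<Psi> has_derivative (\<lambda>h. \<psi> (\<gamma> x) \<odot> h)) (at (\<gamma> x))"
      by (rule \<Psi>) (use G x in auto)
    then have "(\<Psi> \<circ> \<gamma> has_derivative (\<lambda>h. \<psi> (\<gamma> x) \<odot> h) \<circ> (\<lambda>u. u *\<^sub>R ?v)) (at x)"
      using S(2)[OF x] unfolding has_vector_derivative_def
      by (intro diff_chain_at)
    then show "(\<Psi> \<circ> \<gamma> has_vector_derivative \<psi> (\<gamma> x) \<odot> ?v) (at x)"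
      unfolding has_vector_derivative_def by (simp add: o_def bc_mult.scaleR_right)
  next
    have "continuous_on (\<gamma> ` {r..s}) \<Psi>"
      using \<Psi> G by (intro continuous_at_imp_continuous_on) (blast intro: has_derivative_continuous)
    moreover have "continuous_on {r..s} \<gamma>"
      using curve by (simp add: bc_curve_def)
    ultimately show "continuous_on {r..s} (\<Psi> \<circ> \<gamma>)"
      by (intro continuous_on_compose)
  qed
  then show ?thesis
    unfolding bc_line_integral_def by (simp add: integral_unique)
qed

section \<open>The primitive of a path-independent function\<close>

lemma bc_curve_C1:
  assumes "r < s" "continuous_on {r..s} \<gamma>'"
    and "\<And>x. x \<in> {r..s} \<Longrightarrow> (\<gamma> has_vector_derivative \<gamma>' x) (at x within {r..s})"
  shows "bc_curve \<gamma> r s"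
  unfolding bc_curve_def
proof (intro conjI exI[of _ 1] exI[of _ "\<lambda>i. if i = 0 then r else s"])
  show "continuous_on {r..s} \<gamma>"
    using assms(3) by (meson continuous_on_eq_continuous_within has_vector_derivative_continuous)
qed (use assms in auto)

text \<open>By \<open>join\<close>, the combined function agrees with \<open>\<gamma>2\<close> at
  \<open>m\<close> as well, so each closed half keeps its own one-sided derivative there; the two
  may differ.\<close>

lemma bc_curve_C1_C1:
  assumes "r < m" "m < s" "continuous_on {r..m} \<gamma>1'" "continuous_on {m..s} \<gamma>2'"
    and d1: "\<And>x. x \<in> {r..m} \<Longrightarrow> (\<gamma>1 has_vector_derivative \<gamma>1' x) (at x within {r..m})"
    and d2: "\<And>x. x \<in> {m..s} \<Longrightarrow> (\<gamma>2 has_vector_derivative \<gamma>2' x) (at x within {m..s})"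
    and join: "\<gamma>1 m = \<gamma>2 m"
  defines "\<gamma> \<equiv> \<lambda>t. if t \<le> m then \<gamma>1 t else \<gamma>2 t"
  shows "bc_curve \<gamma> r s"
  unfolding bc_curve_def
proof (intro conjI exI[of _ 2] exI[of _ "\<lambda>i. if i = 0 then r else if i = 1 then m else s"])
  have D1: "(\<gamma> has_vector_derivative \<gamma>1' x) (at x within {r..m})" if "x \<in> {r..m}" for x
    using d1[OF that] by (rule has_vector_derivative_transform[OF that, rotated]) (auto simp: \<gamma>_def)
  have D2: "(\<gamma> has_vector_derivative \<gamma>2' x) (at x within {m..s})" if "x \<in> {m..s}" for x
    using d2[OF that]
    by (rule has_vector_derivative_transform[OF that, rotated]) (use join in \<open>auto simp: \<gamma>_def\<close>)
  have "continuous_on ({r..m} \<union> {m..s}) \<gamma>"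
    using D1 D2
    by (intro continuous_on_closed_Un closed_atLeastAtMost)
       (meson continuous_on_eq_continuous_within has_vector_derivative_continuous)+
  then show "continuous_on {r..s} \<gamma>"
    using assms(1,2) by (simp add: ivl_disj_un_two_touch)
  show "\<forall>i<2. (if i = 0 then r else if i = 1 then m else s) <
           (if Suc i = 0 then r else if Suc i = 1 then m else s) \<and>
         (\<exists>\<gamma>'. continuous_on {if i = 0 then r else if i = 1 then m else s..
                    if Suc i = 0 then r else if Suc i = 1 then m else s} \<gamma>' \<and>
           (\<forall>x\<in>{if i = 0 then r else if i = 1 then m else s..
                 if Suc i = 0 then r else if Suc i = 1 then m else s}.
              (\<gamma> has_vector_derivative \<gamma>' x)
                (at x within {if i = 0 then r else if i = 1 then m else s..
                    if Suc i = 0 then r else if Suc i = 1 then m else s})))"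
    using assms(1-4) D1 D2 by (auto simp: less_2_cases_iff)
qed auto

text \<open>On a nondegenerate closed interval the derivative within the interval is unique even at
  the end points, so \<open>vector_derivative\<close> is \<open>\<gamma>'\<close> throughout and the
  integrand is continuous.\<close>

lemma bc_line_integrand_integrable:
  assumes "r < s" "continuous_on {r..s} \<gamma>'"
    and d: "\<And>x. x \<in> {r..s} \<Longrightarrow> (\<gamma> has_vector_derivative \<gamma>' x) (at x within {r..s})"
    and \<psi>: "continuous_on G \<psi>" and G: "\<gamma> ` {r..s} \<subseteq> G"
  shows "(\<lambda>t. \<psi> (\<gamma> t) \<odot> \<gamma>' t) integrable_on {r..s}"
    and "bc_line_integral \<psi> \<gamma> r s = integral {r..s} (\<lambda>t. \<psi> (\<gamma> t) \<odot> \<gamma>' t)"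
proof -
  have "continuous_on {r..s} \<gamma>"
    using d by (meson continuous_on_eq_continuous_within has_vector_derivative_continuous)
  then have "continuous_on {r..s} (\<lambda>t. \<psi> (\<gamma> t))"
    using G by (intro continuous_on_compose2[OF \<psi>]) auto
  then show "(\<lambda>t. \<psi> (\<gamma> t) \<odot> \<gamma>' t) integrable_on {r..s}"
    using assms(2) by (intro integrable_continuous_real bc_mult.continuous_on)
  show "bc_line_integral \<psi> \<gamma> r s = integral {r..s} (\<lambda>t. \<psi> (\<gamma> t) \<odot> \<gamma>' t)"
    unfolding bc_line_integral_def using assms(1) d
    by (intro integral_cong arg_cong2[where f = "(\<odot>)"] refl vector_derivative_within_closed_interval)
       auto
qed

text \<open>At a corner \<open>m\<close> the value of \<open>vector_derivative\<close> is
  uncontrolled. The integrands are therefore compared only inside the two halves, and the finitely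
  many remaining points do not affect the integrals.\<close>

lemma bc_line_integral_C1_C1:
  assumes "r < m" "m < s" "continuous_on {r..m} \<gamma>1'" "continuous_on {m..s} \<gamma>2'"
    and d1: "\<And>x. x \<in> {r..m} \<Longrightarrow> (\<gamma>1 has_vector_derivative \<gamma>1' x) (at x within {r..m})"
    and d2: "\<And>x. x \<in> {m..s} \<Longrightarrow> (\<gamma>2 has_vector_derivative \<gamma>2' x) (at x within {m..s})"
    and \<psi>: "continuous_on G \<psi>" and G1: "\<gamma>1 ` {r..m} \<subseteq> G" and G2: "\<gamma>2 ` {m..s} \<subseteq> G"
  defines "\<gamma> \<equiv> \<lambda>t. if t \<le> m then \<gamma>1 t else \<gamma>2 t"
  shows "bc_line_integral \<psi> \<gamma> r s = bc_line_integral \<psi> \<gamma>1 r m + bc_line_integral \<psi> \<gamma>2 m s"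
proof -
  let ?f = "\<lambda>t. \<psi> (\<gamma> t) \<odot> vector_derivative \<gamma> (at t within {r..s})"
  have vd1: "vector_derivative \<gamma> (at x within {r..s}) = \<gamma>1' x" if x: "x \<in> {r<..<m}" for x
  proof -
    have "(\<gamma>1 has_vector_derivative \<gamma>1' x) (at x)"
      using d1[of x] x by (auto simp: at_within_Icc_at)
    then have "(\<gamma> has_vector_derivative \<gamma>1' x) (at x)"
      by (rule has_vector_derivative_transform_within_open[of _ _ _ "{r<..<m}"])
         (use x in \<open>auto simp: \<gamma>_def\<close>)
    moreover have "at x within {r..s} = at x"
      using x assms(2) by (intro at_within_Icc_at) auto
    ultimately show ?thesis
      by (simp add: vector_derivative_at)
  qed
  have vd2: "vector_derivative \<gamma> (at x within {r..s}) = \<gamma>2' x" if x: "x \<in> {m<..<s}" for x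
  proof -
    have "(\<gamma>2 has_vector_derivative \<gamma>2' x) (at x)"
      using d2[of x] x by (auto simp: at_within_Icc_at)
    then have "(\<gamma> has_vector_derivative \<gamma>2' x) (at x)"
      by (rule has_vector_derivative_transform_within_open[of _ _ _ "{m<..<s}"])
         (use x in \<open>auto simp: \<gamma>_def\<close>)
    moreover have "at x within {r..s} = at x"
      using x assms(1) by (intro at_within_Icc_at) auto
    ultimately show ?thesis
      by (simp add: vector_derivative_at)
  qed
  have I1: "((\<lambda>t. \<psi> (\<gamma>1 t) \<odot> \<gamma>1' t) has_integral bc_line_integral \<psi> \<gamma>1 r m) {r..m}"
    using bc_line_integrand_integrable[OF assms(1,3) d1 \<psi> G1] by (simp add: has_integral_integral)
  have I2: "((\<lambda>t. \<psi> (\<gamma>2 t) \<odot> \<gamma>2' t) has_integral bc_line_integral \<psi> \<gamma>2 m s) {m..s}"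
    using bc_line_integrand_integrable[OF assms(2,4) d2 \<psi> G2] by (simp add: has_integral_integral)
  have "(?f has_integral bc_line_integral \<psi> \<gamma>1 r m) {r..m}"
    by (rule has_integral_spike_finite[of "{r, m}", OF _ _ I1])
       (auto simp: vd1[unfolded \<gamma>_def] \<gamma>_def)
  moreover have "(?f has_integral bc_line_integral \<psi> \<gamma>2 m s) {m..s}"
    by (rule has_integral_spike_finite[of "{m, s}", OF _ _ I2])
       (auto simp: vd2[unfolded \<gamma>_def] \<gamma>_def)
  ultimately have "(?f has_integral bc_line_integral \<psi> \<gamma>1 r m + bc_line_integral \<psi> \<gamma>2 m s) {r..s}"
    using assms(1,2) by (intro has_integral_combine[of r m s]) auto
  then show ?thesis
    unfolding bc_line_integral_def by (rule integral_unique)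
qed

text \<open>Two points of a connected open set are joined inside it by a polynomial path. Its
  parameter is moved to end at 0, so that a segment over \<open>{0..1}\<close> can be appended
  without reparametrization.\<close>

lemma C1_path_in_domain:
  fixes G :: "'a::euclidean_space set"
  assumes "open G" "connected G" "p0 \<in> G" "p \<in> G"
  obtains \<gamma> \<gamma>' where "continuous_on {-1..0} \<gamma>'"
    "\<And>x::real. x \<in> {-1..0} \<Longrightarrow> (\<gamma> has_vector_derivative \<gamma>' x) (at x within {-1..0})"
    "\<gamma> ` {-1..0} \<subseteq> G" "\<gamma> (-1) = p0" "\<gamma> 0 = p"
proof -
  obtain g where g: "polynomial_function g" "path_image g \<subseteq> G" "pathstart g = p0" "pathfinish g = p"
    using connected_open_polynomial_connected[OF assms] by blast
  obtain g' where g': "polynomial_function g'" "\<And>x. (g has_vector_derivative g' x) (at x)"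
    using has_vector_derivative_polynomial_function[OF g(1)] by blast
  show thesis
  proof (rule that[of "\<lambda>x. g' (x + 1)" "\<lambda>x. g (x + 1)"])
    show "continuous_on {-1..0} (\<lambda>x. g' (x + 1))"
      by (intro continuous_on_compose2[OF continuous_on_polymonial_function[OF g'(1), of UNIV]]
            continuous_intros) auto
    show "((\<lambda>x. g (x + 1)) has_vector_derivative g' (x + 1)) (at x within {-1..0})" for x
    proof -
      have "(g \<circ> (\<lambda>x. x + 1) has_vector_derivative 1 *\<^sub>R g' (x + 1)) (at x)"
        by (rule vector_diff_chain_at)
           (use g'(2) in \<open>auto intro!: derivative_eq_intros\<close>)
      then show ?thesis
        by (simp add: o_def has_vector_derivative_at_within)
    qed
    show "(\<lambda>x. g (x + 1)) ` {-1..0} \<subseteq> G"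
      using g(2) by (auto simp: path_image_def image_subset_iff)
  qed (use g in \<open>auto simp: pathstart_def pathfinish_def\<close>)
qed

text \<open>For nonsingular \<open>h\<close> the difference quotient is exactly the mean of
  \<open>\<psi>\<close> over the segment from \<open>p\<close> to \<open>p + h\<close>, which tends
  to \<open>\<psi> p\<close> by continuity.\<close>

lemma bc_has_derivative_segment_integral:
  assumes "open G" "p \<in> G" "continuous_on G \<psi>"
    and seg: "\<And>h. \<lbrakk>closed_segment p (p + h) \<subseteq> G\<rbrakk> \<Longrightarrow>
      \<Psi> (p + h) - \<Psi> p = bc_line_integral \<psi> (\<lambda>t. p + t *\<^sub>R h) 0 1"
  shows "bc_has_derivative \<Psi> (\<psi> p) p"
  unfolding bc_has_derivative_def
proof (rule tendstoI)
  fix e :: real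
  assume "e > 0"
  have "continuous (at p) \<psi>"
    using assms by (simp add: continuous_on_eq_continuous_at)
  \<comment> \<open>Half of \<open>e\<close> is used because the bound on the integral is
    non-strict, while the limit asks for a strict one.\<close>
  then obtain d1 where d1: "d1 > 0" "\<And>q. dist q p < d1 \<Longrightarrow> dist (\<psi> q) (\<psi> p) < e / 2"
    unfolding continuous_at_eps_delta using \<open>e > 0\<close> half_gt_zero by blast
  obtain d2 where d2: "d2 > 0" "ball p d2 \<subseteq> G"
    using assms by (meson open_contains_ball)
  have "dist ((\<Psi> (p + h) - \<Psi> p) \<oslash> h) (\<psi> p) < e"
    if h: "bc_nonsingular h" "norm h < min d1 d2" for h
  proof -
    have small: "norm (t *\<^sub>R h) < min d1 d2" if "t \<in> {0..1}" for t
      using that h(2) mult_right_mono[of t 1 "norm h"] by auto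
    have "p + t *\<^sub>R h \<in> G" if "t \<in> {0..1}" for t
      using small[OF that] d2(2) by (auto simp: dist_norm)
    then have img: "(\<lambda>t. p + t *\<^sub>R h) ` {0..1} \<subseteq> G"
      by blast
    moreover have "closed_segment p (p + h) = (\<lambda>t. p + t *\<^sub>R h) ` {0..1}"
      by (auto simp: closed_segment_image_interval algebra_simps)
    ultimately have "\<Psi> (p + h) - \<Psi> p = bc_line_integral \<psi> (\<lambda>t. p + t *\<^sub>R h) 0 1"
      by (intro seg) simp
    also have "\<dots> = integral {0..1} (\<lambda>t. \<psi> (p + t *\<^sub>R h) \<odot> h)"
      by (rule bc_line_integrand_integrable(2)[OF _ _ _ assms(3) img])
         (auto intro!: derivative_eq_intros)
    \<comment> \<open>The velocity \<open>h\<close> of the segment is constant, so the bounded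
      linear map \<open>\<lambda>x. x \<odot> h\<close> can be taken out of the integral.\<close>
    also have "\<dots> = integral {0..1} (\<lambda>t. \<psi> (p + t *\<^sub>R h)) \<odot> h"
    proof -
      have int: "(\<lambda>t. \<psi> (p + t *\<^sub>R h)) integrable_on {0..1}"
        using img
        by (intro integrable_continuous_real continuous_on_compose2[OF assms(3)] continuous_intros)
      show ?thesis
        using integral_linear[OF int bc_mult.bounded_linear_left[of h]] by (simp add: o_def)
    qed
    finally have quot: "(\<Psi> (p + h) - \<Psi> p) \<oslash> h = integral {0..1} (\<lambda>t. \<psi> (p + t *\<^sub>R h))"
      using h(1) by (simp add: bc_mult_divide_cancel)
    have cont: "continuous_on {0..1} (\<lambda>t. \<psi> (p + t *\<^sub>R h) - \<psi> p)"
      using img by (intro continuous_on_compose2[OF assms(3)] continuous_intros)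
    have "norm (integral {0..1} (\<lambda>t. \<psi> (p + t *\<^sub>R h) - \<psi> p)) \<le> e / 2 * (1 - 0)"
    proof (rule integral_bound[OF _ cont])
      fix t :: real
      assume "t \<in> {0..1}"
      then show "norm (\<psi> (p + t *\<^sub>R h) - \<psi> p) \<le> e / 2"
        using d1(2)[of "p + t *\<^sub>R h"] small[of t] by (auto simp: dist_norm)
    qed simp
    \<comment> \<open>The interval has length 1, so the constant \<open>\<psi> p\<close> is its own
      integral.\<close>
    moreover have "integral {0..1} (\<lambda>t. \<psi> (p + t *\<^sub>R h) - \<psi> p) =
        integral {0..1} (\<lambda>t. \<psi> (p + t *\<^sub>R h)) - \<psi> p"
      using img
      by (subst integral_diff)
         (auto intro!: integrable_continuous_real continuous_on_compose2[OF assms(3)] continuous_intros)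
    ultimately show ?thesis
      using \<open>e > 0\<close> by (simp add: quot dist_norm)
  qed
  then show "eventually (\<lambda>h. dist ((\<Psi> (p + h) - \<Psi> p) \<oslash> h) (\<psi> p) < e)
      (at 0 within {h. bc_nonsingular h})"
    unfolding eventually_at using d1(1) d2(1) by (auto intro!: exI[of _ "min d1 d2"])
qed

text \<open>The primitive at \<open>p\<close> is the integral along a chosen path from a fixed base
  point \<open>p0\<close>. Path independence turns its increments over segments in \<open>G\<close>
  into segment integrals.\<close>

lemma bc_path_independent_imp_primitive:
  assumes "open G" "connected G" and \<psi>: "continuous_on G \<psi>" and indep: "bc_path_independent \<psi> G"
  obtains \<Psi> where "\<And>p. p \<in> G \<Longrightarrow> bc_has_derivative \<Psi> (\<psi> p) p"
proof (cases "G = {}")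
  case True
  then show thesis
    using that by blast
next
  case False
  then obtain p0 where p0: "p0 \<in> G"
    by blast
  have "\<forall>p\<in>G. \<exists>\<gamma> \<gamma>'. continuous_on {-1..0} \<gamma>' \<and>
      (\<forall>x::real\<in>{-1..0}. (\<gamma> has_vector_derivative \<gamma>' x) (at x within {-1..0})) \<and>
      \<gamma> ` {-1..0} \<subseteq> G \<and> \<gamma> (-1) = p0 \<and> \<gamma> 0 = p"
    using C1_path_in_domain[OF assms(1,2) p0] by metis
  then obtain c c' where c: "\<And>p. p \<in> G \<Longrightarrow> continuous_on {-1..0} (c' p)"
      "\<And>p x::real. \<lbrakk>p \<in> G; x \<in> {-1..0}\<rbrakk> \<Longrightarrow>
        (c p has_vector_derivative c' p x) (at x within {-1..0})"
      "\<And>p. p \<in> G \<Longrightarrow> c p ` {-1..0} \<subseteq> G" "\<And>p. p \<in> G \<Longrightarrow> c p (-1) = p0"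
      "\<And>p. p \<in> G \<Longrightarrow> c p 0 = p"
    by metis
  define \<Psi> where "\<Psi> p = bc_line_integral \<psi> (c p) (-1) 0" for p
  have seg: "\<Psi> (p + h) - \<Psi> p = bc_line_integral \<psi> (\<lambda>t. p + t *\<^sub>R h) 0 1"
    if p: "p \<in> G" and ph: "closed_segment p (p + h) \<subseteq> G" for p h
  proof -
    let ?l = "\<lambda>t. p + t *\<^sub>R h"
    let ?\<gamma> = "\<lambda>t. if t \<le> 0 then c p t else ?l t"
    have q: "p + h \<in> G"
      using ph by auto
    have "closed_segment p (p + h) = ?l ` {0..1}"
      by (auto simp: closed_segment_image_interval algebra_simps)
    with ph have l: "?l ` {0..1} \<subseteq> G"
      by simp
    have l': "(?l has_vector_derivative h) (at x within {0..1})" for x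
      by (auto intro!: derivative_eq_intros)
    have "bc_curve ?\<gamma> (-1) 1"
      by (rule bc_curve_C1_C1[OF _ _ c(1)[OF p] _ c(2)[OF p] l']) (use c(5)[OF p] in auto)
    moreover have "bc_curve (c (p + h)) (-1) 0"
      by (rule bc_curve_C1[OF _ c(1)[OF q] c(2)[OF q]]) auto
    moreover have "?\<gamma> ` {-1..1} \<subseteq> G"
      using c(3)[OF p] l by (auto simp: image_subset_iff)
    \<comment> \<open>Two routes from \<open>p0\<close> to \<open>p + h\<close> are compared: the
      chosen path to \<open>p + h\<close>, and the chosen path to \<open>p\<close> followed by the
      segment.\<close>
    ultimately have "\<Psi> (p + h) = bc_line_integral \<psi> ?\<gamma> (-1) 1"
      using indep[unfolded bc_path_independent_def, rule_format,
          of "c (p + h)" "-1" 0 ?\<gamma> "-1" 1] c(3-5)[OF q] c(4)[OF p]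
      by (simp add: \<Psi>_def)
    also have "\<dots> = \<Psi> p + bc_line_integral \<psi> ?l 0 1"
      unfolding \<Psi>_def
      by (rule bc_line_integral_C1_C1[OF _ _ c(1)[OF p] _ c(2)[OF p] l' \<psi> c(3)[OF p] l]) auto
    finally show ?thesis
      by simp
  qed
  show thesis
    using that bc_has_derivative_segment_integral[OF assms(1) _ \<psi> seg] by blast
qed

theorem theorem5p2:
  fixes \<psi> :: "bicomplex \<Rightarrow> bicomplex" and G :: "bicomplex set"
  assumes "open G" and "connected G"
    and "continuous_on G \<psi>"
  shows "bc_path_independent \<psi> G \<longleftrightarrow>
    (\<exists>\<Psi>. bc_holomorphic_on \<Psi> G \<and> (\<forall>p\<in>G. bc_has_derivative \<Psi> (\<psi> p) p))"
proof
  assume "bc_path_independent \<psi> G"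
  then obtain \<Psi> where "\<And>p. p \<in> G \<Longrightarrow> bc_has_derivative \<Psi> (\<psi> p) p"
    using bc_path_independent_imp_primitive[OF assms] by blast
  then show "\<exists>\<Psi>. bc_holomorphic_on \<Psi> G \<and> (\<forall>p\<in>G. bc_has_derivative \<Psi> (\<psi> p) p)"
    unfolding bc_holomorphic_on_def by blast
next
  assume "\<exists>\<Psi>. bc_holomorphic_on \<Psi> G \<and> (\<forall>p\<in>G. bc_has_derivative \<Psi> (\<psi> p) p)"
  then obtain \<Psi> where "bc_holomorphic_on \<Psi> G" "\<forall>p\<in>G. bc_has_derivative \<Psi> (\<psi> p) p"
    by blast
  then have "(\<Psi> has_derivative (\<lambda>h. \<psi> p \<odot> h)) (at p)" if "p \<in> G" for p
    using bc_holomorphic_imp_has_derivative[OF assms(1)] that by blast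
  \<comment> \<open>The right-hand side involves the curve only through its end points, so two
    curves with common end points have equal integrals.\<close>
  then have "bc_line_integral \<psi> \<gamma> r s = \<Psi> (\<gamma> s) - \<Psi> (\<gamma> r)"
    if "bc_curve \<gamma> r s" "\<gamma> ` {r..s} \<subseteq> G" for \<gamma> r s
    using bc_line_integral_primitive[OF that] by blast
  then show "bc_path_independent \<psi> G"
    unfolding bc_path_independent_def by simp
qed

end
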